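(* Let $f$ be an atomic function for NEPv on a neighborhood $\mathrm{St}_\delta(k,n)$ of $\mathrm{St}(k,n)$, with symmetric matrix-valued function $H(P)\in\mathbb{R}^{n\times n}$, subset $\mathbb{P}\subseteq\mathrm{St}(k,n)$ and constants $\underline{\alpha}>0$, $\underline{\beta}\ge0$, $\underline{\gamma}=\underline{\alpha}+\underline{\beta}$. Then the NEPv Ansatz holds for $f$ (with the same $H$ and $\mathbb{P}$) with $\omega=1/\underline{\alpha}$.
   Context: $\mathrm{St}(k,n)=\{P\in\mathbb{R}^{n\times k}: P^{\mathrm T}P=I_k\}$, $1\le k\le n$; $\mathrm{St}_\delta(k,n)=\{P\in\mathbb{R}^{n\times k}:\|P^{\mathrm T}P-I_k\|<\delta\}$ for some $\delta>0$ and some matrix norm. Atomic function for NEPv: a function $f:\mathrm{St}_\delta(k,n)\to\mathbb{R}$ for which there are a symmetric matrix-valued function $H(P)\in\mathbb{R}^{n\times n}$ for $P\in\mathrm{St}(k,n)$, a subset $\mathbb{P}\subseteq\mathrm{St}(k,n)$ and constants $\underline{\alpha}>0$, $\underline{\beta}\ge 0$, $\underline{\gamma}=\underline{\alpha}+\underline{\beta}$ such that (1) $\mathrm{tr}(P^{\mathrm T}H(P)P)=\underline{\gamma} f(P)$ for all $P\in\mathbb{P}$; and (2) given $P\in\mathbb{P}$ and $\widehat P\in\mathrm{St}(k,n)$, there exists $Q\in\mathrm{St}(k,k)$ such that $\widetilde P=\widehat PQ\in\mathbb{P}$ and $\mathrm{tr}(\widehat P^{\mathrm T}H(P)\widehat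 P)\le\underline{\alpha} f(\widetilde P)+\underline{\beta} f(P)$. NEPv Ansatz with constant $\omega>0$ (for $f$ with $H$ and $\mathbb{P}$): whenever $P\in\mathbb{P}$, $\widehat P\in\mathrm{St}(k,n)$ and $\eta\in\mathbb{R}$ satisfy $\mathrm{tr}(\widehat P^{\mathrm T}H(P)\widehat P)\ge\mathrm{tr}(P^{\mathrm T}H(P)P)+\eta$, there exists $Q\in\mathrm{St}(k,k)$ such that $\widetilde P=\widehat PQ\in\mathbb{P}$ and $f(\widetilde P)\ge f(P)+\omega\eta$. *)

theory Defs
  imports "HOL-Analysis.Analysis"
begin

text \<open>
  An \<open>n \<times> k\<close> matrix is an element of \<^typ>\<open>real^'k^'n\<close>, so \<open>k\<close> is \<^term>\<open>CARD('k)\<close>, \<open>n\<close> is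
  \<^term>\<open>CARD('n)\<close>, and \<open>St(k,k)\<close> is the instance of \<open>stiefel\<close> at \<^typ>\<open>real^'k^'k\<close>.
\<close>

definition stiefel :: "(real^'k^'n) set" where
  "stiefel = {P. transpose P ** P = mat 1}"

text \<open>
  Submultiplicativity is not required, so that every vector space norm on the matrices is allowed
  in the definition of the neighbourhood.
\<close>

definition matrix_norm :: "(real^'k^'m \<Rightarrow> real) \<Rightarrow> bool" where
  "matrix_norm nrm \<longleftrightarrow>
     (\<forall>A. 0 \<le> nrm A) \<and>
     (\<forall>A. nrm A = 0 \<longleftrightarrow> A = 0) \<and>
     (\<forall>c A. nrm (c *\<^sub>R A) = \<bar>c\<bar> * nrm A) \<and>
     (\<forall>A B. nrm (A + B) \<le> nrm A + nrm B)"

definition stiefel_nbhd :: "(real^'k^'k \<Rightarrow> real) \<Rightarrow> real \<Rightarrow> (real^'k^'n) set" where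
  "stiefel_nbhd nrm \<delta> = {P. nrm (transpose P ** P - mat 1) < \<delta>}"

lemma stiefel_subset_nbhd:
  assumes "matrix_norm nrm" "\<delta> > 0"
  shows "stiefel \<subseteq> stiefel_nbhd nrm \<delta>"
proof -
  have "nrm 0 = 0"
    using assms(1) unfolding matrix_norm_def by blast
  then show ?thesis
    using assms(2) by (auto simp: stiefel_def stiefel_nbhd_def)
qed

text \<open>
  The functions \<open>f\<close>, defined on \<open>stiefel_nbhd nrm \<delta>\<close>, and \<open>H\<close>, defined on \<open>stiefel\<close>, are represented
  by total functions whose values outside these sets are arbitrary. The membership
  \<open>f \<in> stiefel_nbhd nrm \<delta> \<rightarrow> UNIV\<close> only records the domain and the codomain of \<open>f\<close>; the lemma
  \<open>atomic_for_NEPv_cong\<close> states that the values elsewhere are irrelevant.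
\<close>

definition atomic_for_NEPv ::
  "(real^'k^'k \<Rightarrow> real) \<Rightarrow> real \<Rightarrow> (real^'k^'n \<Rightarrow> real) \<Rightarrow> (real^'k^'n \<Rightarrow> real^'n^'n) \<Rightarrow>
   (real^'k^'n) set \<Rightarrow> real \<Rightarrow> real \<Rightarrow> real \<Rightarrow> bool" where
  "atomic_for_NEPv nrm \<delta> f H PP \<alpha> \<beta> \<gamma> \<longleftrightarrow>
     matrix_norm nrm \<and> \<delta> > 0 \<and>
     f \<in> stiefel_nbhd nrm \<delta> \<rightarrow> (UNIV :: real set) \<and>
     (\<forall>P\<in>stiefel. transpose (H P) = H P) \<and>
     PP \<subseteq> stiefel \<and>
     \<alpha> > 0 \<and> \<beta> \<ge> 0 \<and> \<gamma> = \<alpha> + \<beta> \<and>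
     (\<forall>P\<in>PP. trace (transpose P ** H P ** P) = \<gamma> * f P) \<and>
     (\<forall>P\<in>PP. \<forall>P'\<in>stiefel. \<exists>Q\<in>(stiefel :: (real^'k^'k) set).
        P' ** Q \<in> PP \<and>
        trace (transpose P' ** H P ** P') \<le> \<alpha> * f (P' ** Q) + \<beta> * f P)"

definition NEPv_ansatz ::
  "(real^'k^'n \<Rightarrow> real) \<Rightarrow> (real^'k^'n \<Rightarrow> real^'n^'n) \<Rightarrow> (real^'k^'n) set \<Rightarrow> real \<Rightarrow> bool" where
  "NEPv_ansatz f H PP \<omega> \<longleftrightarrow>
     \<omega> > 0 \<and>
     (\<forall>P\<in>PP. \<forall>P'\<in>stiefel. \<forall>\<eta>.
        trace (transpose P' ** H P ** P') \<ge> trace (transpose P ** H P ** P) + \<eta> \<longrightarrow>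
        (\<exists>Q\<in>(stiefel :: (real^'k^'k) set). P' ** Q \<in> PP \<and> f (P' ** Q) \<ge> f P + \<omega> * \<eta>))"

lemma atomic_for_NEPv_cong:
  fixes f g :: "real^'k^'n \<Rightarrow> real" and H G :: "real^'k^'n \<Rightarrow> real^'n^'n"
  assumes at: "atomic_for_NEPv nrm \<delta> f H PP \<alpha> \<beta> \<gamma>"
    and fg: "\<And>P. P \<in> stiefel_nbhd nrm \<delta> \<Longrightarrow> f P = g P"
    and HG: "\<And>P. P \<in> stiefel \<Longrightarrow> H P = G P"
  shows "atomic_for_NEPv nrm \<delta> g G PP \<alpha> \<beta> \<gamma>"
proof -
  note defs = at[unfolded atomic_for_NEPv_def]
  have nrm: "matrix_norm nrm" "\<delta> > 0"
    and symH: "\<forall>P\<in>stiefel. transpose (H P) = H P"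
    and PP: "PP \<subseteq> stiefel"
    and const: "\<alpha> > 0" "\<beta> \<ge> 0" "\<gamma> = \<alpha> + \<beta>"
    and up: "\<forall>P\<in>PP. \<forall>P'\<in>stiefel. \<exists>Q\<in>(stiefel :: (real^'k^'k) set). P' ** Q \<in> PP \<and>
        trace (transpose P' ** H P ** P') \<le> \<alpha> * f (P' ** Q) + \<beta> * f P"
    and tr: "\<forall>P\<in>PP. trace (transpose P ** H P ** P) = \<gamma> * f P"
    using defs by simp_all
  have eq: "f P = g P" "H P = G P" if "P \<in> PP" for P
    using that fg HG PP stiefel_subset_nbhd[OF nrm] by blast+
  have 1: "\<forall>P\<in>PP. trace (transpose P ** G P ** P) = \<gamma> * g P"
  proof
    fix P assume "P \<in> PP"
    then show "trace (transpose P ** G P ** P) = \<gamma> * g P"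
      using tr eq[of P] by metis
  qed
  have symG: "\<forall>P\<in>stiefel. transpose (G P) = G P"
    using symH HG by simp
  have 2: "\<exists>Q\<in>(stiefel :: (real^'k^'k) set). P' ** Q \<in> PP \<and>
        trace (transpose P' ** G P ** P') \<le> \<alpha> * g (P' ** Q) + \<beta> * g P"
    if P: "P \<in> PP" and P': "P' \<in> stiefel" for P P'
  proof -
    obtain Q :: "real^'k^'k" where "Q \<in> stiefel" "P' ** Q \<in> PP"
      "trace (transpose P' ** H P ** P') \<le> \<alpha> * f (P' ** Q) + \<beta> * f P"
      using bspec[OF bspec[OF up P] P'] by (elim bexE conjE)
    moreover from this have "f (P' ** Q) = g (P' ** Q)"
      by (intro eq(1))
    ultimately show ?thesis
      by (intro bexI[of _ Q]) (simp_all add: eq[OF P, symmetric])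
  qed
  show ?thesis
    unfolding atomic_for_NEPv_def
    by (intro conjI ballI 2) (use nrm symG PP const 1 in simp_all)
qed

end

theory Submission
  imports Defs
begin

text \<open>Both trace values in the Ansatz can be traded for values of \<open>f\<close>: the one at
  \<open>P\<close> equals \<open>\<gamma> * f P\<close>, the one at \<open>P'\<close> is at most
  \<open>\<alpha> * f (P' ** Q) + \<beta> * f P\<close>. Since \<gamma> = \<alpha> + \<beta>, the
  \<beta>-terms cancel, so a trace gain of \<eta> forces \<open>f\<close> to gain at least \<eta> /
  \<alpha>.\<close>

theorem theorem7p3:
  fixes f :: "real^'k^'n \<Rightarrow> real"
    and H :: "real^'k^'n \<Rightarrow> real^'n^'n"
    and PP :: "(real^'k^'n) set"
    and nrm :: "real^'k^'k \<Rightarrow> real"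
    and \<delta> \<alpha> \<beta> \<gamma> :: real
  assumes "CARD('k) \<le> CARD('n)"
    and "atomic_for_NEPv nrm \<delta> f H PP \<alpha> \<beta> \<gamma>"
  shows "NEPv_ansatz f H PP (1 / \<alpha>)"
proof -
  have \<alpha>: "\<alpha> > 0" and \<gamma>: "\<gamma> = \<alpha> + \<beta>"
    and tr: "\<And>P. P \<in> PP \<Longrightarrow> trace (transpose P ** H P ** P) = \<gamma> * f P"
    and up: "\<And>P P'. P \<in> PP \<Longrightarrow> P' \<in> stiefel \<Longrightarrow> \<exists>Q\<in>(stiefel :: (real^'k^'k) set). P' ** Q \<in> PP \<and>
        trace (transpose P' ** H P ** P') \<le> \<alpha> * f (P' ** Q) + \<beta> * f P"
    using assms(2) unfolding atomic_for_NEPv_def by simp_all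
  have "\<exists>Q\<in>(stiefel :: (real^'k^'k) set). P' ** Q \<in> PP \<and> f (P' ** Q) \<ge> f P + 1 / \<alpha> * \<eta>"
    if P: "P \<in> PP" and P': "P' \<in> stiefel"
      and ge: "trace (transpose P' ** H P ** P') \<ge> trace (transpose P ** H P ** P) + \<eta>"
    for P P' \<eta>
  proof -
    \<comment> \<open>The aligning factor supplied by atomicity depends only on \<open>P\<close> and
      \<open>P'\<close>; it is also the witness for the Ansatz.\<close>
    obtain Q :: "real^'k^'k" where Q: "Q \<in> stiefel" "P' ** Q \<in> PP"
      and le: "trace (transpose P' ** H P ** P') \<le> \<alpha> * f (P' ** Q) + \<beta> * f P"
      using up[OF P P'] by blast
    have "(\<alpha> + \<beta>) * f P + \<eta> \<le> \<alpha> * f (P' ** Q) + \<beta> * f P"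
      using ge le tr[OF P] \<gamma> by simp
    \<comment> \<open>With \<open>\<beta> * f P\<close> cancelled,
      \<open>\<alpha> * f P + \<eta> \<le> \<alpha> * f (P' ** Q)\<close> remains; dividing by
      \<alpha> > 0 preserves the inequality.\<close>
    then have "f P + 1 / \<alpha> * \<eta> \<le> f (P' ** Q)"
      using \<alpha> by (simp add: field_simps)
    with Q show ?thesis by blast
  qed
  with \<alpha> show ?thesis
    unfolding NEPv_ansatz_def by simp
qed

end
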